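(* ($\kappa$-bound) Let $\mathcal I=(1,m,n,\mathcal X,\mathcal X^{(S)},R)$ be an instance of the ICCSI problem over $\mathbb F_q$ (with $t=1$) and let $\delta\ge0$ be an integer. Then $$\mathcal N(\mathcal I,\delta)\le N(\kappa(\mathcal I),2\delta+1).$$
   Context: Notation: $q$ is a prime power, $\mathbb F_q$ the field with $q$ elements, $[m]=\{1,\dots,m\}$. For a matrix $A$, $A_i$ is its $i$-th row and $\langle A\rangle$ its row space. $w$ is the Hamming weight (number of nonzero entries) of a vector. Instance (with $t=1$): positive integers $m,n$; subspaces $\mathcal X^{(S)}$ and $\mathcal X^{(i)}$ ($i\in[m]$) of $\mathbb F_q^n$ of dimensions $d_S$ and $d_i$; $\mathcal X=\{A\in\mathbb F_q^{m\times n}:A_i\in\mathcal X^{(i)}\}$; a matrix $R\in\mathbb F_q^{m\times n}$ with rows $R_i\in\mathcal X^{(S)}\setminus\mathcal X^{(i)}$. Fix $V^{(S)}\in\mathbb F_q^{d_S\times n}$, $V^{(i)}\in\mathbb F_q^{d_i\times n}$ with $\langle V^{(S)}\rangle=\mathcal X^{(S)}$, $\langle V^{(i)}\rangle=\mathcal X^{(i)}$. Error-correcting index codes: $L\in\mathbb F_q^{N\times d_S}$ ($N$ a positive integer) represents an $\mathbb F_q$-linear $(\mathcal I,\delta)$-ECIC of length $N$ if for each $i\in[m]$ there is a map $D_i:\mathbb F_q^N\times\mathbb F_q^{d_i}\to\mathbb F_q$ with $D_i(LV^{(S)}X+W,V^{(i)}X)=R_iX$ for all $X\in\mathbb F_q^n$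 and all $W\in\mathbb F_q^N$ with $w(W)\le\delta$. $\mathcal N(\mathcal I,\delta)$ is the minimum length $N$ of an $\mathbb F_q$-linear $(\mathcal I,\delta)$-ECIC. $N(k,d)$ is the minimum $\ell$ such that there is a $k$-dimensional $\mathbb F_q$-linear code in $\mathbb F_q^\ell$ of minimum Hamming distance $d$. The min-rank is $\kappa(\mathcal I)=\min\{\operatorname{rank}(A+R):A\in\mathbb F_q^{m\times n},\ A_i\in\mathcal X^{(i)}\cap\mathcal X^{(S)}\ \forall i\in[m]\}$. *)

theory Defs
  imports "Jordan_Normal_Form.DL_Rank"
begin

text \<open>
  The field with \<open>q\<close> elements is a type \<open>'a :: {field, finite}\<close>; rows and clients are
  indexed by \<open>0, \<dots>, m - 1\<close>.
\<close>

abbreviation is_vec_subspace :: "nat \<Rightarrow> 'a::field vec set \<Rightarrow> bool" where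
  "is_vec_subspace n W \<equiv> subspace class_ring W (module_vec TYPE('a) n)"

abbreviation vec_subspace_dim :: "nat \<Rightarrow> 'a::field vec set \<Rightarrow> nat" where
  "vec_subspace_dim n W \<equiv>
     vectorspace.dim class_ring ((module_vec TYPE('a) n)\<lparr>carrier := W\<rparr>)"

definition hamming_weight :: "'a::zero vec \<Rightarrow> nat" where
  "hamming_weight v = card {i. i < dim_vec v \<and> v $ i \<noteq> 0}"

definition hamming_dist :: "'a vec \<Rightarrow> 'a vec \<Rightarrow> nat" where
  "hamming_dist x y = card {i. i < dim_vec x \<and> x $ i \<noteq> y $ i}"

text \<open>
  A code with fewer than two words has no minimum distance: the predicate below is then false
  for every \<open>d\<close>.
\<close>

definition has_min_distance :: "'a vec set \<Rightarrow> nat \<Rightarrow> bool" where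
  "has_min_distance C d \<longleftrightarrow>
     (\<exists>x\<in>C. \<exists>y\<in>C. x \<noteq> y \<and> hamming_dist x y = d) \<and>
     (\<forall>x\<in>C. \<forall>y\<in>C. x \<noteq> y \<longrightarrow> d \<le> hamming_dist x y)"

text \<open>
  \<open>N(k, d)\<close>. As with every \<open>LEAST\<close> below, the set of admissible naturals is meant to be nonempty;
  here it is for all \<open>k, d \<ge> 1\<close> (use \<open>k\<close> disjoint blocks of length \<open>d\<close>).
\<close>

definition min_code_length :: "'a::{field,finite} itself \<Rightarrow> nat \<Rightarrow> nat \<Rightarrow> nat" where
  "min_code_length _ k d =
     (LEAST l. \<exists>C :: 'a vec set.
        is_vec_subspace l C \<and> vec_subspace_dim l C = k \<and> has_min_distance C d)"

text \<open>
  An instance \<open>(1, m, n, \<X>, X\<^sup>(\<^sup>S\<^sup>), R)\<close>, that is, with block length \<open>t = 1\<close>, together with the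
  subspaces \<open>X\<^sup>(\<^sup>i\<^sup>)\<close> from which \<open>\<X>\<close> is formed and the dimensions of all the subspaces.
\<close>

locale iccsi_instance =
  fixes m n :: nat
    and XX :: "'a::{field,finite} mat set"
    and XS :: "'a vec set" and Xi :: "nat \<Rightarrow> 'a vec set"
    and dS :: nat and di :: "nat \<Rightarrow> nat"
    and R :: "'a mat"
  assumes m_pos: "0 < m" and n_pos: "0 < n"
    and XS_subspace: "is_vec_subspace n XS"
    and XS_dim: "vec_subspace_dim n XS = dS"
    and Xi_subspace: "\<And>i. i < m \<Longrightarrow> is_vec_subspace n (Xi i)"
    and Xi_dim: "\<And>i. i < m \<Longrightarrow> vec_subspace_dim n (Xi i) = di i"
    and XX_eq: "XX = {A \<in> carrier_mat m n. \<forall>i<m. row A i \<in> Xi i}"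
    and R_carrier: "R \<in> carrier_mat m n"
    and R_rows: "\<And>i. i < m \<Longrightarrow> row R i \<in> XS - Xi i"

definition min_rank ::
  "nat \<Rightarrow> nat \<Rightarrow> 'a::{field,finite} vec set \<Rightarrow> (nat \<Rightarrow> 'a vec set) \<Rightarrow> 'a mat \<Rightarrow> nat" where
  "min_rank m n XS Xi R =
     (LEAST r. \<exists>A \<in> carrier_mat m n.
        (\<forall>i<m. row A i \<in> Xi i \<inter> XS) \<and> vec_space.rank m (A + R) = r)"

text \<open>
  The matrix \<open>L\<close> represents a linear \<open>\<delta>\<close>-error-correcting index code of length \<open>N\<close>; \<open>VS\<close> and
  \<open>Vi i\<close> are the chosen generator matrices, with \<open>dS\<close> and \<open>di i\<close> rows. Decoders are total on
  all vectors, but only their values on vectors of lengths \<open>N\<close> and \<open>di i\<close> matter.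
\<close>

definition represents_ecic ::
  "nat \<Rightarrow> nat \<Rightarrow> nat \<Rightarrow> 'a::{field,finite} mat \<Rightarrow> (nat \<Rightarrow> 'a mat) \<Rightarrow> 'a mat \<Rightarrow> nat \<Rightarrow> nat
     \<Rightarrow> 'a mat \<Rightarrow> bool" where
  "represents_ecic m n dS VS Vi R \<delta> N L \<longleftrightarrow>
     0 < N \<and> L \<in> carrier_mat N dS \<and>
     (\<forall>i<m. \<exists>D :: 'a vec \<Rightarrow> 'a vec \<Rightarrow> 'a.
        \<forall>X \<in> carrier_vec n. \<forall>W \<in> carrier_vec N. hamming_weight W \<le> \<delta> \<longrightarrow>
          D ((L * VS) *\<^sub>v X + W) (Vi i *\<^sub>v X) = row R i \<bullet> X)"

definition opt_ecic_length ::
  "nat \<Rightarrow> nat \<Rightarrow> nat \<Rightarrow> 'a::{field,finite} mat \<Rightarrow> (nat \<Rightarrow> 'a mat) \<Rightarrow> 'a mat \<Rightarrow> nat \<Rightarrow> nat" where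
  "opt_ecic_length m n dS VS Vi R \<delta> = (LEAST N. \<exists>L. represents_ecic m n dS VS Vi R \<delta> N L)"

end

theory Submission
  imports Defs
begin

text \<open>
  Let \<open>M = A + R\<close> attain the min-rank \<open>\<kappa>\<close>, and let \<open>B\<close> and \<open>G\<close> be injective matrices whose ranges
  are the column space of \<open>M\<close> and an optimal \<open>\<kappa>\<close>-dimensional code of minimum distance
  \<open>2 \<delta> + 1\<close>. With \<open>Y\<close> a left inverse of \<open>B\<close>, the matrix \<open>G * Y\<close> maps the column space of \<open>M\<close>
  injectively into the code; the rows of \<open>M\<close> lie in the row space of \<open>VS\<close>, so \<open>M = Q * VS\<close>, and
  \<open>L = G * (Y * Q)\<close> transmits \<open>M X\<close> encoded by the code. Unique decoding recovers \<open>M X\<close>, and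
  client \<open>i\<close> subtracts from its \<open>i\<close>-th entry the value \<open>A\<^sub>i X\<close>, which its side information determines.
\<close>

section \<open>Linear algebra: bases, ranges of matrices, left inverses, row spaces\<close>

context vec_space
begin

lemma col_space_eq_range:
  assumes A: "A \<in> carrier_mat n k"
  shows "col_space A = (\<lambda>x. A *\<^sub>v x) ` carrier_vec k"
  unfolding col_space_eq[OF A] using A by (auto simp: mult_mat_vec_carrier[of _ n k])

lemma col_space_subspace:
  assumes "A \<in> carrier_mat n k"
  shows "subspace class_ring (col_space A) V"
  unfolding col_space_def using span_is_subspace cols_dim[of A] assms by auto

text \<open>Sizes of independent sets are bounded by the dimension, so a maximal one between
  \<open>S\<close> and \<open>W\<close> exists; a vector of \<open>W\<close> outside its span could
  still be added. This serves both to find a basis of a subspace and to complete given columns to a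
  basis of the whole space.\<close>

lemma lin_indpt_extend_maximal:
  assumes "S \<subseteq> W" "W \<subseteq> carrier_vec n" "lin_indpt S"
  obtains T where "S \<subseteq> T" "T \<subseteq> W" "lin_indpt T" "finite T" "W \<subseteq> span T"
proof -
  let ?P = "\<lambda>T. S \<subseteq> T \<and> T \<subseteq> W \<and> lin_indpt T"
  have "\<exists>T. finite T \<and> maximal T ?P"
  proof (rule maximal_exists)
    show "finite A \<and> card A \<le> dim" if "?P A" for A
      using li_le_dim[OF fin_dim, of A] that assms(2) by auto
    show "?P S" using assms by auto
  qed
  then obtain T where T: "finite T" "maximal T ?P" by auto
  then have P: "S \<subseteq> T" "T \<subseteq> W" "lin_indpt T" by (auto simp: maximal_def)
  have "v \<in> span T" if v: "v \<in> W" for v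
  proof (rule ccontr)
    assume nv: "v \<notin> span T"
    have Tc: "T \<subseteq> carrier_vec n" using P(2) assms(2) by auto
    then have "v \<notin> T" using nv in_own_span[of T] by auto
    moreover have "lin_indpt (T \<union> {v})"
      using lin_dep_iff_in_span[of T v] Tc P nv v assms(2) \<open>v \<notin> T\<close> by auto
    then have "?P (T \<union> {v})" using P v by auto
    ultimately show False using T(2) unfolding maximal_def by blast
  qed
  then show ?thesis using that[of T] P T(1) by blast
qed

lemma mat_of_cols_lin_indpt_inj:
  assumes "set bs \<subseteq> carrier_vec n" "distinct bs" "lin_indpt (set bs)"
    and "x \<in> carrier_vec (length bs)" "mat_of_cols n bs *\<^sub>v x = 0\<^sub>v n"
  shows "x = 0\<^sub>v (length bs)"
  using lin_depI[of "mat_of_cols n bs" "length bs" x] assms by (auto simp: cols_mat_of_cols)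

text \<open>The columns of \<open>B\<close> form a basis of \<open>W\<close>. This puts coordinates
  on both the column space of the min-rank matrix and the optimal code.\<close>

lemma subspace_eq_range_mat:
  assumes W: "subspace class_ring W V"
    and k: "vectorspace.dim class_ring (V\<lparr>carrier := W\<rparr>) = k"
  obtains B where "B \<in> carrier_mat n k"
    "\<And>x. x \<in> carrier_vec k \<Longrightarrow> B *\<^sub>v x = 0\<^sub>v n \<Longrightarrow> x = 0\<^sub>v k"
    "W = (\<lambda>x. B *\<^sub>v x) ` carrier_vec k"
proof -
  have Wc: "W \<subseteq> carrier_vec n"
    using W unfolding subspace_def submodule_def by auto
  have "lin_indpt {}" unfolding lin_dep_def by auto
  then obtain T where T: "T \<subseteq> W" "lin_indpt T" "finite T" "W \<subseteq> span T"
    using lin_indpt_extend_maximal[of "{}" W] Wc by auto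
  have Tc: "T \<subseteq> carrier_vec n" using T(1) Wc by auto
  have WT: "W = span T"
    using T(1,4) span_is_subset[of T W] W unfolding subspace_def by auto
  \<comment> \<open>\<open>dim_span\<close> reads the dimension off a maximal independent subset of
    a spanning set; here the spanning set is \<open>T\<close> itself.\<close>
  have "maximal T (\<lambda>U. U \<subseteq> T \<and> lin_indpt U)"
    using T(2) unfolding maximal_def by auto
  then have cT: "card T = k"
    using dim_span[of T T] Tc T(3) k WT by auto
  obtain bs where bs: "set bs = T" "distinct bs" using finite_distinct_list[OF T(3)] by auto
  have len: "length bs = k" using bs cT distinct_card by force
  let ?B = "mat_of_cols n bs"
  have B: "?B \<in> carrier_mat n k" using len by auto
  have cB: "cols ?B = bs" using bs Tc by (simp add: cols_mat_of_cols)
  have "W = col_space ?B" unfolding col_space_def cB bs WT ..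
  also have "\<dots> = (\<lambda>x. ?B *\<^sub>v x) ` carrier_vec k"
    by (rule col_space_eq_range[OF B])
  finally have "W = (\<lambda>x. ?B *\<^sub>v x) ` carrier_vec k" .
  moreover have "x = 0\<^sub>v k" if "x \<in> carrier_vec k" "?B *\<^sub>v x = 0\<^sub>v n" for x
    using mat_of_cols_lin_indpt_inj[of bs x] that bs T Tc len by auto
  ultimately show ?thesis using that B by blast
qed

text \<open>Independence concerns the set of columns and so ignores repetitions. Distinctness is
  therefore a separate claim: equal columns \<open>i\<close> and \<open>j\<close> would put the
  difference of two unit vectors into the kernel.\<close>

lemma inj_mat_distinct_lin_indpt_cols:
  assumes B: "B \<in> carrier_mat n k"
    and inj: "\<And>x. x \<in> carrier_vec k \<Longrightarrow> B *\<^sub>v x = 0\<^sub>v n \<Longrightarrow> x = 0\<^sub>v k"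
  shows "distinct (cols B)" "lin_indpt (set (cols B))"
proof -
  show d: "distinct (cols B)"
  proof (rule ccontr)
    assume "\<not> distinct (cols B)"
    then obtain i j where ij: "i < k" "j < k" "i \<noteq> j" "col B i = col B j"
      using B by (auto simp: distinct_conv_nth)
    let ?x = "unit_vec k i - unit_vec k j :: 'a vec"
    have "B *\<^sub>v ?x = 0\<^sub>v n"
    proof (rule eq_vecI)
      fix r assume "r < dim_vec (0\<^sub>v n :: 'a vec)"
      then have r: "r < n" by simp
      have "B $$ (r, i) = col B i $ r" "B $$ (r, j) = col B j $ r" using B r ij(1,2) by auto
      then have "B $$ (r, i) = B $$ (r, j)" using ij(4) by simp
      then show "(B *\<^sub>v ?x) $ r = 0\<^sub>v n $ r"
        using B r ij(1,2) by (simp add: scalar_prod_minus_distrib[of _ k])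
    qed (use B in simp)
    then have "?x = 0\<^sub>v k" using inj[of ?x] by simp
    then have "?x $ i = 0\<^sub>v k $ i" by simp
    then show False using ij by simp
  qed
  show "lin_indpt (set (cols B))"
  proof
    assume "lin_dep (set (cols B))"
    then show False using lin_depE[OF B _ d] inj by metis
  qed
qed

text \<open>Counterpart of \<open>subspace_eq_range_mat\<close>: it certifies the dimension of a
  code given by a generator matrix.\<close>

lemma range_mat_subspace_dim:
  assumes B: "B \<in> carrier_mat n k"
    and inj: "\<And>x. x \<in> carrier_vec k \<Longrightarrow> B *\<^sub>v x = 0\<^sub>v n \<Longrightarrow> x = 0\<^sub>v k"
  shows "subspace class_ring ((\<lambda>x. B *\<^sub>v x) ` carrier_vec k) V"
    "vectorspace.dim class_ring (V\<lparr>carrier := (\<lambda>x. B *\<^sub>v x) ` carrier_vec k\<rparr>) = k"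
proof -
  note eq = col_space_eq_range[OF B, symmetric]
  show "subspace class_ring ((\<lambda>x. B *\<^sub>v x) ` carrier_vec k) V"
    unfolding eq by (rule col_space_subspace[OF B])
  show "vectorspace.dim class_ring (V\<lparr>carrier := (\<lambda>x. B *\<^sub>v x) ` carrier_vec k\<rparr>) = k"
    unfolding eq col_space_def
    using lin_indpt_full_rank[OF B inj_mat_distinct_lin_indpt_cols[OF assms]] unfolding rank_def .
qed

text \<open>Complete the columns of \<open>B\<close> to a basis, invert the resulting square matrix
  and keep the first \<open>k\<close> rows of the inverse.\<close>

lemma inj_mat_left_inverse:
  fixes B :: "'a mat"
  assumes B: "B \<in> carrier_mat n k"
    and inj: "\<And>x. x \<in> carrier_vec k \<Longrightarrow> B *\<^sub>v x = 0\<^sub>v n \<Longrightarrow> x = 0\<^sub>v k"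
  obtains Y where "Y \<in> carrier_mat k n" "Y * B = 1\<^sub>m k"
proof -
  note ind = inj_mat_distinct_lin_indpt_cols[OF assms]
  obtain T where T: "set (cols B) \<subseteq> T" "T \<subseteq> carrier_vec n" "lin_indpt T" "finite T"
      "carrier_vec n \<subseteq> span T"
    using lin_indpt_extend_maximal[of "set (cols B)" "carrier_vec n"] ind cols_dim[of B] B by auto
  have "basis T" unfolding basis_def using T span_is_subset2[of T] by auto
  then have cT: "card T = n" using dim_basis[OF T(4)] dim_is_n by simp
  obtain cs where cs: "set cs = T - set (cols B)" "distinct cs"
    using finite_distinct_list[of "T - set (cols B)"] T(4) by auto
  let ?bs = "cols B @ cs"
  have bs: "set ?bs = T" "distinct ?bs" using cs T(1) ind by auto
  have len: "length ?bs = n" using distinct_card[OF bs(2)] bs(1) cT by simp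
  let ?E = "mat_of_cols n ?bs"
  have E: "?E \<in> carrier_mat n n" by (rule mat_of_cols_carrier(1)[of n ?bs, unfolded len])
  have cE: "cols ?E = ?bs" using bs(1) T(2) by (intro cols_mat_of_cols) simp
  have "rank ?E = n"
    by (rule lin_indpt_full_rank[OF E]) (unfold cE bs(1), use bs T in auto)
  then have "det ?E \<noteq> 0" using det_rank_iff[OF E] by simp
  then have "?E \<in> Units (ring_mat TYPE('a) n ())" by (rule det_non_zero_imp_unit[OF E])
  then obtain Ei where Ei: "Ei \<in> carrier_mat n n" "Ei * ?E = 1\<^sub>m n"
    unfolding Units_def by (auto simp: ring_mat_def)
  have kn: "k \<le> n" using len B by auto
  \<comment> \<open>The columns of \<open>B\<close> come first in \<open>?E\<close>, so
    \<open>Y * B\<close> will be the upper left block of \<open>Ei * ?E\<close>.\<close>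
  define Y where "Y = mat k n (\<lambda>(i,j). Ei $$ (i,j))"
  have Y: "Y \<in> carrier_mat k n" unfolding Y_def by simp
  have "Y * B = 1\<^sub>m k"
  proof (rule eq_matI)
    fix i j assume ij: "i < dim_row (1\<^sub>m k :: 'a mat)" "j < dim_col (1\<^sub>m k :: 'a mat)"
    then have ij': "i < k" "j < k" "i < n" "j < n" using kn by auto
    have "row Y i = row Ei i" using ij' Ei(1) by (intro eq_vecI) (auto simp: Y_def)
    moreover have "col B j = col ?E j"
    proof -
      have "col ?E j = cols ?E ! j" using ij' E by (metis carrier_matD(2) cols_nth)
      then show ?thesis unfolding cE using ij' B by (simp add: nth_append)
    qed
    ultimately have "(Y * B) $$ (i,j) = (Ei * ?E) $$ (i,j)"
      using ij' Y B Ei(1) E by simp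
    then show "(Y * B) $$ (i,j) = 1\<^sub>m k $$ (i,j)" using ij' Ei(2) by simp
  qed (use Y B in auto)
  then show ?thesis using that Y by blast
qed

text \<open>Row \<open>i\<close> of \<open>Q\<close> lists coefficients that express row
  \<open>i\<close> of \<open>M\<close> through the rows of \<open>A\<close>.\<close>

lemma rows_in_row_space_factor:
  assumes A: "A \<in> carrier_mat nr n" and M: "M \<in> carrier_mat m n"
    and rows: "\<And>i. i < m \<Longrightarrow> row M i \<in> row_space A"
  obtains Q where "Q \<in> carrier_mat m nr" "M = Q * A"
proof -
  have "\<exists>y \<in> carrier_vec nr. A\<^sup>T *\<^sub>v y = row M i" if "i < m" for i
    using rows[OF that] A unfolding row_space_eq[OF A] by auto
  then obtain y where y: "\<And>i. i < m \<Longrightarrow> y i \<in> carrier_vec nr \<and> A\<^sup>T *\<^sub>v y i = row M i"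
    by metis
  let ?Q = "mat m nr (\<lambda>(i,j). y i $ j)"
  have "M = ?Q * A"
  proof (rule eq_matI)
    fix i j assume "i < dim_row (?Q * A)" "j < dim_col (?Q * A)"
    then have ij: "i < m" "j < n" using A by auto
    have rQ: "row ?Q i = y i" using ij y[of i] by (intro eq_vecI) auto
    have "M $$ (i,j) = row M i $ j" using ij M by simp
    also have "\<dots> = (A\<^sup>T *\<^sub>v y i) $ j" using y ij by simp
    also have "\<dots> = col A j \<bullet> y i" using ij A by simp
    also have "\<dots> = y i \<bullet> col A j"
      using y[OF ij(1)] A by (intro comm_scalar_prod[of _ nr]) auto
    also have "\<dots> = (?Q * A) $$ (i,j)" using ij A rQ by simp
    finally show "M $$ (i,j) = (?Q * A) $$ (i,j)" .
  qed (use M A in auto)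
  then show ?thesis using that[of ?Q] by simp
qed

text \<open>Writing \<open>v\<close> as \<open>A\<^sup>T *\<^sub>v y\<close> gives
  \<open>v \<bullet> X = y \<bullet> (A *\<^sub>v X)\<close>. With \<open>A\<close> a client's
  generator matrix, this is the part of the data that side information determines.\<close>

lemma scalar_prod_row_space_cong:
  assumes A: "A \<in> carrier_mat nr n" and v: "v \<in> row_space A"
    and X: "X \<in> carrier_vec n" "X' \<in> carrier_vec n" and eq: "A *\<^sub>v X = A *\<^sub>v X'"
  shows "v \<bullet> X = v \<bullet> X'"
proof -
  obtain y where y: "y \<in> carrier_vec nr" "A\<^sup>T *\<^sub>v y = v"
    using v A unfolding row_space_eq[OF A] by auto
  have "v \<bullet> Z = y \<bullet> (A *\<^sub>v Z)" if "Z \<in> carrier_vec n" for Z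
    using transpose_vec_mult_scalar[of A nr n Z y] A y that by simp
  then show ?thesis using X eq by simp
qed

end

section \<open>Error-correcting codes, and decoders for index codes\<close>

text \<open>The witness is the code repeating each of the \<open>k\<close> message symbols \<open>d\<close> times.\<close>

lemma linear_code_exists:
  assumes "0 < k" "0 < d"
  obtains l and C :: "'a::field vec set"
  where "is_vec_subspace l C" "vec_subspace_dim l C = k" "has_min_distance C d"
proof -
  let ?l = "k * d"
  define B :: "'a mat" where "B = mat ?l k (\<lambda>(i, j). if i div d = j then 1 else 0)"
  have B: "B \<in> carrier_mat ?l k" unfolding B_def by simp
  have div_less: "i div d < k" if "i < ?l" for i
    using that assms by (simp add: less_mult_imp_div_less)
  have Bx: "(B *\<^sub>v x) $ i = x $ (i div d)" if x: "x \<in> carrier_vec k" and i: "i < ?l" for x i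
  proof -
    have "(B *\<^sub>v x) $ i = (\<Sum>j = 0..<k. (if i div d = j then 1 else 0) * x $ j)"
      using x i B unfolding B_def by (auto simp: scalar_prod_def)
    also have "\<dots> = (\<Sum>j = 0..<k. if i div d = j then x $ j else 0)"
      by (intro sum.cong) auto
    also have "\<dots> = x $ (i div d)" using div_less[OF i] by (simp add: sum.delta)
    finally show ?thesis .
  qed
  have block: "r * d < ?l" "r * d div d = r" if "r < k" for r
    using that assms(2) by auto
  have inj: "x = 0\<^sub>v k" if x: "x \<in> carrier_vec k" and z: "B *\<^sub>v x = 0\<^sub>v ?l" for x
  proof (rule eq_vecI)
    fix r assume "r < dim_vec (0\<^sub>v k :: 'a vec)"
    then have r: "r < k" by simp
    have "x $ r = (B *\<^sub>v x) $ (r * d)" using Bx[OF x block(1)[OF r]] block(2)[OF r] by simp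
    then show "x $ r = 0\<^sub>v k $ r" using z r block(1)[OF r] by simp
  qed (use x in simp)
  let ?C = "(\<lambda>x. B *\<^sub>v x) ` carrier_vec k"
  have dist: "d \<le> hamming_dist (B *\<^sub>v x) (B *\<^sub>v y)"
    if xy: "x \<in> carrier_vec k" "y \<in> carrier_vec k" "B *\<^sub>v x \<noteq> B *\<^sub>v y" for x y
  proof -
    have "x \<noteq> y" using xy(3) by auto
    then obtain r where r: "r < k" "x $ r \<noteq> y $ r" using xy(1,2) by (auto simp: vec_eq_iff)
    \<comment> \<open>One differing symbol \<open>r\<close> already produces \<open>d\<close>
      differences, one at each position of its block.\<close>
    have "{r * d..<r * d + d} \<subseteq> {i. i < ?l \<and> (B *\<^sub>v x) $ i \<noteq> (B *\<^sub>v y) $ i}"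
    proof
      fix i assume i: "i \<in> {r * d..<r * d + d}"
      have "i div d = r" using i by (intro div_nat_eqI) (auto simp: algebra_simps)
      moreover have "r * d + d \<le> ?l" using mult_le_mono1[of "Suc r" k d] r(1) by simp
      then have "i < ?l" using i by simp
      ultimately show "i \<in> {i. i < ?l \<and> (B *\<^sub>v x) $ i \<noteq> (B *\<^sub>v y) $ i}"
        using r(2) Bx xy(1,2) by simp
    qed
    from card_mono[OF _ this] show ?thesis unfolding hamming_dist_def using B by simp
  qed
  \<comment> \<open>The minimum distance has to be attained: the message with the single nonzero
    symbol 0 and the zero message have codewords that differ exactly on the first block.\<close>
  let ?e = "unit_vec k 0 :: 'a vec"
  have d0: "hamming_dist (B *\<^sub>v ?e) (B *\<^sub>v 0\<^sub>v k) = d"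
  proof -
    have "{i. i < ?l \<and> (B *\<^sub>v ?e) $ i \<noteq> (B *\<^sub>v 0\<^sub>v k) $ i} = {..<d}"
    proof -
      have "i < ?l \<and> (B *\<^sub>v ?e) $ i \<noteq> (B *\<^sub>v 0\<^sub>v k) $ i \<longleftrightarrow> i < ?l \<and> i div d = 0" for i
        using Bx[of ?e i] Bx[of "0\<^sub>v k" i] div_less[of i] assms(1) by (auto split: if_splits)
      moreover have "i < ?l \<and> i div d = 0 \<longleftrightarrow> i < d" for i
        using assms by (cases k) (auto simp: div_eq_0_iff)
      ultimately show ?thesis by auto
    qed
    then show ?thesis unfolding hamming_dist_def using B by simp
  qed
  then have "B *\<^sub>v ?e \<noteq> B *\<^sub>v 0\<^sub>v k" using assms(2) by (auto simp: hamming_dist_def)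
  then have "has_min_distance ?C d"
    unfolding has_min_distance_def using d0 dist by fastforce
  then show ?thesis using that vec_space.range_mat_subspace_dim[OF B inj] by blast
qed

text \<open>The two codewords can differ only where \<open>W\<close> or \<open>W'\<close> is
  nonzero, hence in at most \<open>2 * \<delta>\<close> positions.\<close>

lemma unique_decoding:
  fixes C :: "'a::ab_group_add vec set"
  assumes C: "has_min_distance C (2 * \<delta> + 1)"
    and c: "c \<in> C" "c' \<in> C" "c \<in> carrier_vec l" "c' \<in> carrier_vec l"
    and W: "W \<in> carrier_vec l" "W' \<in> carrier_vec l"
    and weight: "hamming_weight W \<le> \<delta>" "hamming_weight W' \<le> \<delta>"
    and eq: "c + W = c' + W'"
  shows "c = c'"
proof (rule ccontr)
  assume "c \<noteq> c'"
  then have "2 * \<delta> + 1 \<le> hamming_dist c c'" using C c unfolding has_min_distance_def by auto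
  also have "\<dots> \<le> card ({i. i < l \<and> W $ i \<noteq> 0} \<union> {i. i < l \<and> W' $ i \<noteq> 0})"
    unfolding hamming_dist_def
  proof (intro card_mono subsetI)
    fix i assume "i \<in> {i. i < dim_vec c \<and> c $ i \<noteq> c' $ i}"
    then have i: "i < l" "c $ i \<noteq> c' $ i" using c by auto
    have "c $ i + W $ i = c' $ i + W' $ i" using arg_cong[OF eq, of "\<lambda>v. v $ i"] i c W by simp
    then show "i \<in> {i. i < l \<and> W $ i \<noteq> 0} \<union> {i. i < l \<and> W' $ i \<noteq> 0}" using i by auto
  qed auto
  also have "\<dots> \<le> hamming_weight W + hamming_weight W'"
    using card_Un_le[of "{i. i < l \<and> W $ i \<noteq> 0}" "{i. i < l \<and> W' $ i \<noteq> 0}"] W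
    unfolding hamming_weight_def by simp
  finally show False using weight by simp
qed

text \<open>No decoding procedure has to be designed: if data that look alike to a client always
  agree on its demand, the decoder may pick any data consistent with what it sees and answer for
  those.\<close>

lemma represents_ecicI:
  fixes R VS :: "'a::{field,finite} mat"
  assumes "0 < N" "L \<in> carrier_mat N dS"
    and "\<And>i X X' (W :: 'a vec) W'. \<lbrakk>i < m; X \<in> carrier_vec n; X' \<in> carrier_vec n;
      W \<in> carrier_vec N; W' \<in> carrier_vec N; hamming_weight W \<le> \<delta>; hamming_weight W' \<le> \<delta>;
      (L * VS) *\<^sub>v X + W = (L * VS) *\<^sub>v X' + W'; Vi i *\<^sub>v X = Vi i *\<^sub>v X'\<rbrakk>
      \<Longrightarrow> row R i \<bullet> X = row R i \<bullet> X'"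
  shows "represents_ecic m n dS VS Vi R \<delta> N L"
  unfolding represents_ecic_def
proof (intro conjI allI impI)
  fix i assume i: "i < m"
  let ?ok = "\<lambda>(y :: 'a vec) (z :: 'a vec) (X :: 'a vec). X \<in> carrier_vec n \<and>
    (\<exists>W \<in> carrier_vec N. hamming_weight W \<le> \<delta> \<and> (L * VS) *\<^sub>v X + W = y) \<and> Vi i *\<^sub>v X = z"
  let ?D = "\<lambda>y z. row R i \<bullet> (SOME X. ?ok y z X)"
  show "\<exists>D. \<forall>X \<in> carrier_vec n. \<forall>W \<in> carrier_vec N. hamming_weight W \<le> \<delta> \<longrightarrow>
    D ((L * VS) *\<^sub>v X + W) (Vi i *\<^sub>v X) = row R i \<bullet> X"
  proof (intro exI[of _ ?D] ballI impI)
    fix X W :: "'a vec"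
    assume X: "X \<in> carrier_vec n" and W: "W \<in> carrier_vec N" "hamming_weight W \<le> \<delta>"
    let ?y = "(L * VS) *\<^sub>v X + W" and ?z = "Vi i *\<^sub>v X"
    \<comment> \<open>The true \<open>X\<close> is itself consistent, so the choice succeeds. The
      chosen vector may differ from \<open>X\<close> and come with another error
      \<open>W'\<close>.\<close>
    have "?ok ?y ?z (SOME X. ?ok ?y ?z X)"
      by (rule someI[of "?ok ?y ?z" X]) (use X W in blast)
    then obtain W' where "(SOME X. ?ok ?y ?z X) \<in> carrier_vec n" "W' \<in> carrier_vec N"
        "hamming_weight W' \<le> \<delta>" "(L * VS) *\<^sub>v (SOME X. ?ok ?y ?z X) + W' = ?y"
        "Vi i *\<^sub>v (SOME X. ?ok ?y ?z X) = ?z"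
      by blast
    then show "?D ?y ?z = row R i \<bullet> X" by (intro assms(3)[OF i _ X _ W(1) _ W(2)])
  qed
qed (use assms in auto)

section \<open>The bound: encoding a min-rank matrix by an optimal code\<close>

theorem mainTheorem8:
  fixes m n dS \<delta> :: nat and di :: "nat \<Rightarrow> nat"
    and XX :: "'a::{field,finite} mat set"
    and XS :: "'a vec set" and Xi :: "nat \<Rightarrow> 'a vec set"
    and R VS :: "'a mat" and Vi :: "nat \<Rightarrow> 'a mat"
  assumes "iccsi_instance m n XX XS Xi dS di R"
    and "VS \<in> carrier_mat dS n" and "vec_space.row_space n VS = XS"
    and "\<And>i. i < m \<Longrightarrow> Vi i \<in> carrier_mat (di i) n"
    and "\<And>i. i < m \<Longrightarrow> vec_space.row_space n (Vi i) = Xi i"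
  shows "opt_ecic_length m n dS VS Vi R \<delta>
           \<le> min_code_length TYPE('a) (min_rank m n XS Xi R) (2 * \<delta> + 1)"
proof -
  interpret iccsi_instance m n XX XS Xi dS di R by (rule assms(1))
  let ?\<kappa> = "min_rank m n XS Xi R"
  let ?P = "\<lambda>r. \<exists>A \<in> carrier_mat m n.
    (\<forall>i<m. row A i \<in> Xi i \<inter> XS) \<and> vec_space.rank m (A + R) = r"
  have zero_in: "0\<^sub>v n \<in> W" if "is_vec_subspace n W" for W :: "'a vec set"
    using that unfolding subspace_def submodule_def by (auto simp: module_vec_simps)
  \<comment> \<open>The zero matrix is an admissible \<open>A\<close>, so the set of ranks is
    nonempty and its least element is attained.\<close>
  have "?P (vec_space.rank m (0\<^sub>m m n + R))"
    using zero_in[OF XS_subspace] zero_in[OF Xi_subspace] by (intro bexI[of _ "0\<^sub>m m n"]) auto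
  then have "?P ?\<kappa>" unfolding min_rank_def by (rule LeastI)
  then obtain A where A: "A \<in> carrier_mat m n" "\<And>i. i < m \<Longrightarrow> row A i \<in> Xi i"
      "\<And>i. i < m \<Longrightarrow> row A i \<in> XS" and rank: "vec_space.rank m (A + R) = ?\<kappa>"
    by blast
  define M where "M = A + R"
  have M: "M \<in> carrier_mat m n" unfolding M_def using R_carrier by simp
  have row_M: "row M i = row A i + row R i" if "i < m" for i
    unfolding M_def using that A(1) R_carrier by (intro eq_vecI) auto

  note colspace = vec_space.col_space_eq_range[OF M] and sub = vec_space.col_space_subspace[OF M]
  have dim: "vec_subspace_dim m (vec_space.col_space m M) = ?\<kappa>"
    using rank unfolding M_def[symmetric] vec_space.col_space_def vec_space.rank_def .
  obtain B where B: "B \<in> carrier_mat m ?\<kappa>"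
      "\<And>x. x \<in> carrier_vec ?\<kappa> \<Longrightarrow> B *\<^sub>v x = 0\<^sub>v m \<Longrightarrow> x = 0\<^sub>v ?\<kappa>"
      "vec_space.col_space m M = (\<lambda>x. B *\<^sub>v x) ` carrier_vec ?\<kappa>"
    using vec_space.subspace_eq_range_mat[OF sub dim] by blast
  obtain Y where Y: "Y \<in> carrier_mat ?\<kappa> m" "Y * B = 1\<^sub>m ?\<kappa>"
    using vec_space.inj_mat_left_inverse[OF B(1,2)] by blast

  \<comment> \<open>If \<open>\<kappa> = 0\<close>, then \<open>R = - A\<close> has its rows in the side-information spaces.\<close>
  have "?\<kappa> > 0"
  proof (rule ccontr)
    assume "\<not> ?\<kappa> > 0"
    then have \<kappa>: "?\<kappa> = 0" by simp
    have Mx: "M *\<^sub>v x = 0\<^sub>v m" if x: "x \<in> carrier_vec n" for x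
    proof -
      obtain z where "z \<in> carrier_vec ?\<kappa>" "M *\<^sub>v x = B *\<^sub>v z" using colspace B(3) x by blast
      \<comment> \<open>Here \<open>z\<close> has length 0, so every entry of
        \<open>B *\<^sub>v z\<close> is an empty sum.\<close>
      then show ?thesis using B(1) \<kappa> by (intro eq_vecI) (auto simp: scalar_prod_def)
    qed
    have "row M 0 $ j = 0" if "j < n" for j
      using arg_cong[OF Mx[of "unit_vec n j"], of "\<lambda>v. v $ 0"] m_pos M that by simp
    then have "row A 0 $ j + row R 0 $ j = 0" if "j < n" for j
      using that row_M[OF m_pos] R_carrier m_pos by (metis carrier_matD index_add_vec(1) index_row(2))
    then have "row R 0 = (- 1) \<cdot>\<^sub>v row A 0"
      using A(1) R_carrier by (intro eq_vecI) (simp_all add: eq_neg_iff_add_eq_0 add.commute)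
    moreover have "(- 1) \<cdot>\<^sub>v row A 0 \<in> Xi 0"
      using submodule.smult_closed[of class_ring "Xi 0" "module_vec TYPE('a) n" "- 1" "row A 0"]
        Xi_subspace[OF m_pos] A(2)[OF m_pos]
      unfolding subspace_def by (simp add: module_vec_simps class_ring_simps)
    ultimately have "row R 0 \<in> Xi 0" by simp
    then show False using R_rows[OF m_pos] by simp
  qed
  let ?l = "min_code_length TYPE('a) ?\<kappa> (2 * \<delta> + 1)"
  let ?Q = "\<lambda>l. \<exists>C :: 'a vec set. is_vec_subspace l C \<and> vec_subspace_dim l C = ?\<kappa> \<and>
    has_min_distance C (2 * \<delta> + 1)"
  \<comment> \<open>A code of dimension 0 has a single word and thus no minimum distance; positivity
    of \<open>?\<kappa>\<close> is what makes this \<open>LEAST\<close> attained.\<close>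
  have "\<exists>l. ?Q l"
    by (rule linear_code_exists[OF \<open>?\<kappa> > 0\<close>, of "2 * \<delta> + 1"]) auto
  then have "?Q ?l" unfolding min_code_length_def by (rule LeastI_ex)
  then obtain C :: "'a vec set" where C: "is_vec_subspace ?l C" "vec_subspace_dim ?l C = ?\<kappa>"
    "has_min_distance C (2 * \<delta> + 1)" by blast
  obtain G where G: "G \<in> carrier_mat ?l ?\<kappa>"
      "\<And>x. x \<in> carrier_vec ?\<kappa> \<Longrightarrow> G *\<^sub>v x = 0\<^sub>v ?l \<Longrightarrow> x = 0\<^sub>v ?\<kappa>"
      "C = (\<lambda>x. G *\<^sub>v x) ` carrier_vec ?\<kappa>"
    using vec_space.subspace_eq_range_mat[OF C(1,2)] by blast
  \<comment> \<open>Index codes must have positive length. Words of length 0 are at distance 0, but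
    the code attains \<open>2 * \<delta> + 1\<close>.\<close>
  have "?l > 0"
  proof (rule ccontr)
    assume "\<not> ?l > 0"
    then have l: "?l = 0" by simp
    obtain x y where "x \<in> C" "hamming_dist x y = 2 * \<delta> + 1"
      using C(3) unfolding has_min_distance_def by blast
    moreover have "dim_vec x = 0" using \<open>x \<in> C\<close> G(1,3) l by auto
    ultimately show False unfolding hamming_dist_def by simp
  qed

  \<comment> \<open>The min-rank confines the rows of \<open>A\<close> to \<open>XS\<close> as well;
    together with the rows of \<open>R\<close> this keeps \<open>M\<close> computable from what the
    sender holds.\<close>
  have "row M i \<in> vec_space.row_space n VS" if "i < m" for i
    using submodule.m_closed[of class_ring XS "module_vec TYPE('a) n" "row A i" "row R i"]
      XS_subspace A(3)[OF that] R_rows[OF that]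
    unfolding assms(3) row_M[OF that] subspace_def by (simp add: module_vec_simps)
  then obtain Q where Q: "Q \<in> carrier_mat m dS" "M = Q * VS"
    using vec_space.rows_in_row_space_factor[OF assms(2) M] by blast
  let ?L = "G * (Y * Q)"
  have L: "?L \<in> carrier_mat ?l dS" using G Y Q by auto
  \<comment> \<open>The message is the coordinate vector \<open>z\<close> of
    \<open>M *\<^sub>v X\<close> with respect to the columns of \<open>B\<close>; \<open>Y\<close>
    recovers it because \<open>Y * B\<close> is the identity.\<close>
  have enc: "\<exists>z \<in> carrier_vec ?\<kappa>. M *\<^sub>v X = B *\<^sub>v z \<and> (?L * VS) *\<^sub>v X = G *\<^sub>v z"
    if X: "X \<in> carrier_vec n" for X
  proof -
    obtain z where z: "z \<in> carrier_vec ?\<kappa>" "M *\<^sub>v X = B *\<^sub>v z" using colspace B(3) X by blast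
    have "?L * VS = G * (Y * M)"
      unfolding Q(2) using G(1) Y(1) Q(1) assms(2)
      by (simp add: assoc_mult_mat[of _ ?l ?\<kappa> _ dS _ n] assoc_mult_mat[of _ ?\<kappa> m _ dS _ n])
    then have "(?L * VS) *\<^sub>v X = G *\<^sub>v (Y *\<^sub>v (M *\<^sub>v X))"
      using G(1) Y(1) M X
      by (simp add: assoc_mult_mat_vec[of _ ?l ?\<kappa> _ n] assoc_mult_mat_vec[of _ ?\<kappa> m _ n])
    also have "Y *\<^sub>v (M *\<^sub>v X) = (Y * B) *\<^sub>v z"
      using z Y(1) B(1) by (simp add: assoc_mult_mat_vec[of _ ?\<kappa> m _ ?\<kappa>])
    finally show ?thesis using z Y(2) by auto
  qed
  have "represents_ecic m n dS VS Vi R \<delta> ?l ?L"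
  proof (rule represents_ecicI[OF \<open>?l > 0\<close> L])
    fix i X X' and W W' :: "'a vec"
    assume i: "i < m" and X: "X \<in> carrier_vec n" "X' \<in> carrier_vec n"
      and W: "W \<in> carrier_vec ?l" "W' \<in> carrier_vec ?l"
        "hamming_weight W \<le> \<delta>" "hamming_weight W' \<le> \<delta>"
      and eq: "(?L * VS) *\<^sub>v X + W = (?L * VS) *\<^sub>v X' + W'"
      and side: "Vi i *\<^sub>v X = Vi i *\<^sub>v X'"
    obtain z where z: "z \<in> carrier_vec ?\<kappa>" "M *\<^sub>v X = B *\<^sub>v z" "(?L * VS) *\<^sub>v X = G *\<^sub>v z"
      using enc[OF X(1)] by blast
    obtain z' where z': "z' \<in> carrier_vec ?\<kappa>" "M *\<^sub>v X' = B *\<^sub>v z'"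
        "(?L * VS) *\<^sub>v X' = G *\<^sub>v z'"
      using enc[OF X(2)] by blast
    have Gz: "G *\<^sub>v z \<in> C" "G *\<^sub>v z' \<in> C" "G *\<^sub>v z \<in> carrier_vec ?l" "G *\<^sub>v z' \<in> carrier_vec ?l"
      using G z z' by auto
    have "G *\<^sub>v z = G *\<^sub>v z'"
      using unique_decoding[OF C(3) Gz W] eq z z' by simp
    \<comment> \<open>Injectivity of \<open>G\<close> is available as a trivial kernel, so it is
      applied to the difference of the two messages.\<close>
    then have "G *\<^sub>v (z - z') = 0\<^sub>v ?l"
      using G(1) z z' Gz by (simp add: mult_minus_distrib_mat_vec[of _ ?l ?\<kappa>])
    then have "z - z' = 0\<^sub>v ?\<kappa>" using G(2) z z' by simp
    then have "(z - z') $ j = 0" if "j < ?\<kappa>" for j using that by simp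
    then have "z $ j = z' $ j" if "j < ?\<kappa>" for j using z(1) z'(1) that by simp
    then have "z = z'" using z(1) z'(1) by (intro eq_vecI) auto
    then have "M *\<^sub>v X = M *\<^sub>v X'" using z z' by simp
    then have "row M i \<bullet> X = row M i \<bullet> X'"
      using i M by (metis carrier_matD(1) index_mult_mat_vec)
    then have "row A i \<bullet> X + row R i \<bullet> X = row A i \<bullet> X' + row R i \<bullet> X'"
      using row_M[OF i] A(1) R_carrier X i by (simp add: add_scalar_prod_distrib[of _ n])
    moreover have "row A i \<bullet> X = row A i \<bullet> X'"
      using vec_space.scalar_prod_row_space_cong[OF assms(4)[OF i] _ X side] A(2)[OF i] assms(5)[OF i]
      by simp
    ultimately show "row R i \<bullet> X = row R i \<bullet> X'" by simp
  qed
  then show ?thesis unfolding opt_ecic_length_def by (intro Least_le) blast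
qed

end
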